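(* Let $a$ and $b$ be positive coprime integers with $2a \le b$. (1) If $ab$ is even, then for every integer $n \ge (a+b-1)(3a+b-1)$ there exists an $(a,b)$-necklace of length $n$. (2) If $ab$ is odd, then for every even integer $n \ge (a+b-2)(3a+b-2)/2$ there exists an $(a,b)$-necklace of length $n$.
   Context: For positive integers $a<b$ and $n \ge 3$, an $(a,b)$-necklace of length $n$ is a circular arrangement of the integers $0,1,\ldots,n-1$ (each used exactly once) such that any two adjacent entries (beads) have difference $\pm a$ or $\pm b$; the first and last entries count as adjacent. Equivalently, it is a Hamiltonian cycle in the graph $G_{a,b}(n)$ with vertex set $\{0,1,\ldots,n-1\}$ in which $x,y$ are adjacent if and only if $|x-y| \in \{a,b\}$. *)

theory Defs
  imports Main
begin

text \<open>
  A necklace is given by listing its beads around the circle from an arbitrary starting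
  bead in one of the two directions. For \<open>n \<ge> 3\<close> such a list is the same thing as a
  Hamiltonian cycle, with a chosen start and orientation, in the graph on \<open>{0..<n}\<close> in which
  \<open>x\<close> and \<open>y\<close> are adjacent iff their distance is \<open>a\<close> or \<open>b\<close>. Differences are taken in
  the integers, since subtraction on the natural numbers truncates.
\<close>

definition necklace_adj :: "nat \<Rightarrow> nat \<Rightarrow> nat \<Rightarrow> nat \<Rightarrow> bool" where
  "necklace_adj a b x y \<longleftrightarrow> \<bar>int x - int y\<bar> \<in> {int a, int b}"

definition is_necklace :: "nat \<Rightarrow> nat \<Rightarrow> nat \<Rightarrow> nat list \<Rightarrow> bool" where
  "is_necklace a b n xs \<longleftrightarrow>
     n \<ge> 3 \<and> length xs = n \<and> distinct xs \<and> set xs = {0..<n} \<and>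
     (\<forall>i<n. necklace_adj a b (xs ! i) (xs ! (Suc i mod n)))"

end

theory Submission
  imports Defs "HOL-Number_Theory.Cong"
begin

text \<open>
  On \<open>{0..<a + b}\<close> the map \<open>x \<mapsto> (x + b) mod (a + b)\<close> moves every bead by \<open>b\<close> or \<open>-a\<close> and is a
  single cycle. Shifting this cycle by \<open>2a\<close> and replacing each edge from \<open>w\<close> to \<open>w - a\<close> with
  \<open>a + b \<le> w < 2a + b\<close> by the detour \<open>w, w - b, w - b - a, w - a\<close> picks up the \<open>2a\<close> missing beads and
  gives a necklace of length \<open>3a + b\<close>. A necklace of length \<open>m\<close> containing the edge
  \<open>{m - b + y, m - b + y + a}\<close> is spliced with a translate by \<open>m\<close> of one containing \<open>{y, y + a}\<close>, by
  exchanging these two parallel edges for the two edges of length \<open>b\<close> joining their ends. So all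
  lengths \<open>s (a + b) + t (3a + b)\<close> occur, and the two bounds are the Frobenius bounds for \<open>a + b\<close>
  and \<open>3a + b\<close>, respectively for their halves.
\<close>

section \<open>Edges of paths and cycles\<close>

fun path_edges :: "'a list \<Rightarrow> 'a set set" where
  "path_edges (x # y # zs) = insert {x, y} (path_edges (y # zs))"
| "path_edges _ = {}"

text \<open>Edges are unordered sets, so rotating or reversing the list does not change them and a
  cycle may be cut at any edge.\<close>

definition cycle_edges :: "'a list \<Rightarrow> 'a set set" where
  "cycle_edges xs = insert {last xs, hd xs} (path_edges xs)"

lemma path_edges_subset_cycle_edges: "path_edges xs \<subseteq> cycle_edges xs"
  by (auto simp: cycle_edges_def)

lemma path_edges_append:
  "xs \<noteq> [] \<Longrightarrow> ys \<noteq> [] \<Longrightarrow>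
    path_edges (xs @ ys) = insert {last xs, hd ys} (path_edges xs \<union> path_edges ys)"
proof (induction xs rule: path_edges.induct)
  case ("2_2" x)
  then show ?case by (cases ys) auto
qed auto

lemma path_edges_rev: "path_edges (rev xs) = path_edges xs"
proof (induction xs rule: path_edges.induct)
  case (1 x y zs)
  have "path_edges (rev (x # y # zs)) = path_edges (rev (y # zs) @ [x])"
    by simp
  also have "\<dots> = insert {x, y} (path_edges (y # zs))"
    using 1 by (subst path_edges_append) (auto simp: insert_commute)
  finally show ?case by simp
qed auto

lemma path_edges_map: "path_edges (map f xs) = (`) f ` path_edges xs"
  by (induction xs rule: path_edges.induct) auto

lemma path_edges_split:
  assumes "e \<in> path_edges xs"
  obtains us vs where "xs = us @ vs" "us \<noteq> []" "vs \<noteq> []" "e = {last us, hd vs}"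
  using assms
proof (induction xs arbitrary: thesis rule: path_edges.induct)
  case (1 x y zs)
  show ?case
  proof (cases "e = {x, y}")
    case True
    then show ?thesis using "1.prems"(1)[of "[x]" "y # zs"] by simp
  next
    case False
    then have "e \<in> path_edges (y # zs)" using "1.prems"(2) by simp
    then obtain us vs where "y # zs = us @ vs" "us \<noteq> []" "vs \<noteq> []" "e = {last us, hd vs}"
      using "1.IH" by metis
    then show ?thesis using "1.prems"(1)[of "x # us" vs] by simp
  qed
qed auto

lemma nth_path_edges: "Suc i < length xs \<Longrightarrow> {xs ! i, xs ! Suc i} \<in> path_edges xs"
proof (induction xs arbitrary: i rule: path_edges.induct)
  case (1 x y zs)
  then show ?case by (cases i) auto
qed auto

lemma nth_cycle_edges:
  assumes "i < length xs"
  shows "{xs ! i, xs ! (Suc i mod length xs)} \<in> cycle_edges xs"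
proof (cases "Suc i < length xs")
  case True
  then show ?thesis using nth_path_edges[OF True] by (simp add: cycle_edges_def)
next
  case False
  then have "Suc i = length xs" using assms by simp
  moreover from this have "i = length xs - 1" "xs \<noteq> []" by auto
  ultimately show ?thesis
    by (simp add: cycle_edges_def last_conv_nth hd_conv_nth)
qed

lemma cycle_edges_rev: "xs \<noteq> [] \<Longrightarrow> cycle_edges (rev xs) = cycle_edges xs"
  by (simp add: cycle_edges_def path_edges_rev hd_rev last_rev insert_commute)

lemma cycle_edges_append_commute:
  "xs \<noteq> [] \<Longrightarrow> ys \<noteq> [] \<Longrightarrow> cycle_edges (xs @ ys) = cycle_edges (ys @ xs)"
  by (auto simp: cycle_edges_def path_edges_append)

text \<open>Rotation turns any edge into the closing one, and reversal decides which of its ends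
  comes first.\<close>

lemma cut_cycle:
  assumes "{u, v} \<in> cycle_edges xs" "xs \<noteq> []" "distinct xs"
  obtains zs where "zs \<noteq> []" "distinct zs" "set zs = set xs" "cycle_edges zs = cycle_edges xs"
    "hd zs = u" "last zs = v"
proof -
  obtain zs where zs: "zs \<noteq> []" "distinct zs" "set zs = set xs"
    "cycle_edges zs = cycle_edges xs" "{u, v} = {last zs, hd zs}"
  proof (cases "{u, v} = {last xs, hd xs}")
    case True
    then show ?thesis using that assms by blast
  next
    case False
    then have "{u, v} \<in> path_edges xs" using assms by (auto simp: cycle_edges_def)
    then obtain us vs where "xs = us @ vs" "us \<noteq> []" "vs \<noteq> []" "{u, v} = {last us, hd vs}"
      by (rule path_edges_split)
    then show ?thesis
      using that[of "vs @ us"] assms cycle_edges_append_commute[of vs us] by auto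
  qed
  show ?thesis
  proof (cases "hd zs = u \<and> last zs = v")
    case True
    then show ?thesis using that zs by blast
  next
    case False
    then have "last zs = u \<and> hd zs = v" using zs(5) by (auto simp: doubleton_eq_iff)
    then show ?thesis
      using that[of "rev zs"] zs by (simp add: cycle_edges_rev hd_rev last_rev)
  qed
qed

lemma path_edges_concat:
  assumes "\<And>i. g i \<noteq> []"
  shows "path_edges (concat (map g [0..<Suc k])) =
    (\<Union>i<Suc k. path_edges (g i)) \<union> (\<Union>i<k. {{last (g i), hd (g (Suc i))}})"
proof (induction k)
  case (Suc k)
  have ne: "concat (map g [0..<Suc k]) \<noteq> []" using assms by simp
  have "last (concat (map g [0..<Suc k])) = last (g k)"
    using assms by simp
  moreover have "concat (map g [0..<Suc (Suc k)]) = concat (map g [0..<Suc k]) @ g (Suc k)"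
    by simp
  ultimately have "path_edges (concat (map g [0..<Suc (Suc k)])) = 
     insert {last (g k), hd (g (Suc k))} (path_edges (concat (map g [0..<Suc k])) \<union> path_edges (g (Suc k)))"
    using path_edges_append[OF ne assms, of "Suc k"] by presburger
  then show ?case unfolding Suc.IH by (auto simp: lessThan_Suc)
qed (simp add: lessThan_Suc)

lemma cycle_edges_concat:
  assumes "\<And>i. g i \<noteq> []" "0 < k"
  shows "cycle_edges (concat (map g [0..<k])) =
    (\<Union>i<k. insert {last (g i), hd (g (Suc i mod k))} (path_edges (g i)))"
proof -
  obtain l where l: "k = Suc l" using assms(2) gr0_implies_Suc by blast
  have "hd (concat (map g [0..<k])) = hd (g 0)"
    using assms(1) by (simp add: l upt_rec[of 0] del: upt_Suc)
  moreover have "last (concat (map g [0..<k])) = last (g l)"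
    using assms(1) by (simp add: l)
  moreover have "(\<Union>i<l. {{last (g i), hd (g (Suc i))}}) =
      (\<Union>i<l. {{last (g i), hd (g (Suc i mod k))}})"
    by (rule SUP_cong) (auto simp: l)
  ultimately show ?thesis
    unfolding cycle_edges_def l path_edges_concat[where k=l and g=g, OF assms(1)]
    by (auto simp: lessThan_Suc)
qed

section \<open>Cyclic lists over the residues\<close>

lemma bij_betw_mult_mod:
  fixes b n :: nat
  assumes "coprime b n" "0 < n"
  shows "bij_betw (\<lambda>i. i * b mod n) {..<n} {..<n}"
proof -
  have "inj_on (\<lambda>i. i * b mod n) {..<n}"
  proof (rule inj_onI)
    fix i j assume ij: "i \<in> {..<n}" "j \<in> {..<n}" "i * b mod n = j * b mod n"
    then have "[i * b = j * b] (mod n)" by (simp add: cong_def)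
    then have "[i = j] (mod n)"
      using assms(1) by (simp add: cong_mult_rcancel_nat coprime_commute)
    then show "i = j" using ij by (simp add: cong_def)
  qed
  moreover have "(\<lambda>i. i * b mod n) ` {..<n} \<subseteq> {..<n}" using assms(2) by auto
  ultimately show ?thesis
    by (simp add: bij_betw_def endo_inj_surj)
qed

text \<open>Since \<open>b\<close> is a unit mod \<open>n\<close>, its multiples run once through
  all residues. Each residue \<open>x\<close> contributes a block \<open>D x\<close>; blocks with
  several beads will hold the detours.\<close>

lemma concat_residue_cycle:
  fixes b n :: nat
  assumes "coprime b n" "0 < n" and ne: "\<And>x. D x \<noteq> []" and dist: "\<And>x. distinct (D x)"
    and disj: "\<And>x y. x \<noteq> y \<Longrightarrow> set (D x) \<inter> set (D y) = {}"
  obtains xs where "distinct xs" "set xs = (\<Union>x<n. set (D x))"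
    "cycle_edges xs = (\<Union>x<n. insert {last (D x), hd (D ((x + b) mod n))} (path_edges (D x)))"
proof -
  define f where "f = (\<lambda>i. i * b mod n)"
  have bij: "bij_betw f {..<n} {..<n}" unfolding f_def by (rule bij_betw_mult_mod[OF assms(1,2)])
  then have inj: "inj_on f {..<n}" and im: "f ` {..<n} = {..<n}"
    by (auto simp: bij_betw_def)
  define xs where "xs = concat (map (\<lambda>i. D (f i)) [0..<n])"
  have "distinct xs"
    unfolding xs_def
  proof (subst distinct_concat_iff, intro conjI allI impI)
    have "D (f i) \<noteq> D (f j)" if "i < n" "j < n" "i \<noteq> j" for i j
    proof -
      have "f i \<noteq> f j" using that inj by (auto simp: inj_on_def)
      then show ?thesis using disj[of "f i" "f j"] ne[of "f i"] by auto
    qed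
    then have "inj_on (\<lambda>i. D (f i)) {0..<n}"
      by (intro inj_onI) (metis atLeastLessThan_iff)
    moreover have "removeAll [] (map (\<lambda>i. D (f i)) [0..<n]) = map (\<lambda>i. D (f i)) [0..<n]"
      using ne by (intro removeAll_id) (auto dest: sym)
    ultimately show "distinct (removeAll [] (map (\<lambda>i. D (f i)) [0..<n]))"
      by (simp add: distinct_map)
  next
    fix ys assume "ys \<in> set (map (\<lambda>i. D (f i)) [0..<n])"
    then show "distinct ys" using dist by auto
  next
    fix ys zs
    assume "ys \<in> set (map (\<lambda>i. D (f i)) [0..<n]) \<and> zs \<in> set (map (\<lambda>i. D (f i)) [0..<n]) \<and> ys \<noteq> zs"
    then obtain i j where "ys = D (f i)" "zs = D (f j)" "ys \<noteq> zs" by auto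
    then show "set ys \<inter> set zs = {}" by (metis disj)
  qed
  moreover have "set xs = (\<Union>x\<in>f ` {..<n}. set (D x))"
    by (auto simp: xs_def)
  moreover have "cycle_edges xs =
    (\<Union>x\<in>f ` {..<n}. insert {last (D x), hd (D ((x + b) mod n))} (path_edges (D x)))"
  proof -
    \<comment> \<open>The wrap-around fits the pattern: \<open>n * b\<close> is again residue
      \<open>0\<close>, so the closing edge also belongs to a step by \<open>b\<close>.\<close>
    have "f (Suc i mod n) = (f i + b) mod n" for i
      by (simp add: f_def mod_simps add.commute)
    then show ?thesis
      unfolding xs_def by (subst cycle_edges_concat) (use ne assms(2) in auto)
  qed
  ultimately show ?thesis using that im by simp
qed

section \<open>Splicing necklaces\<close>

text \<open>These are the edges on all naturals; without an upper bound on the beads the set is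
  closed under translation.\<close>

definition step_edges :: "nat \<Rightarrow> nat \<Rightarrow> nat set set" where
  "step_edges a b = range (\<lambda>x. {x, x + a}) \<union> range (\<lambda>x. {x, x + b})"

lemma step_edges_translate: "e \<in> step_edges a b \<Longrightarrow> (+) m ` e \<in> step_edges a b"
  unfolding step_edges_def by (auto simp: add.assoc[symmetric])

lemma step_edges_iff: "{x, y} \<in> step_edges a b \<longleftrightarrow> necklace_adj a b x y"
proof -
  have "necklace_adj a b x y \<longleftrightarrow> y = x + a \<or> x = y + a \<or> y = x + b \<or> x = y + b"
    unfolding necklace_adj_def by auto
  then show ?thesis
    by (auto simp: step_edges_def doubleton_eq_iff)
qed

text \<open>The last two edges are the handles for splicing: the upper one, raised by
  \<open>b\<close>, is the lower one of a copy translated by \<open>m\<close>. Fixing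
  \<open>y\<close> independently of \<open>m\<close> lets splicing be iterated.\<close>

definition spliceable :: "nat \<Rightarrow> nat \<Rightarrow> nat \<Rightarrow> nat \<Rightarrow> nat list \<Rightarrow> bool" where
  "spliceable a b y m xs \<longleftrightarrow> b < m \<and> distinct xs \<and> set xs = {0..<m} \<and>
     cycle_edges xs \<subseteq> step_edges a b \<and>
     {y, y + a} \<in> cycle_edges xs \<and> {m - b + y, m - b + y + a} \<in> cycle_edges xs"

lemma spliceable_is_necklace:
  assumes "spliceable a b y m xs" "2 \<le> b"
  shows "is_necklace a b m xs"
proof -
  have xs: "length xs = m" "distinct xs" "set xs = {0..<m}" "3 \<le> m"
    using assms distinct_card[of xs] by (auto simp: spliceable_def)
  have "necklace_adj a b (xs ! i) (xs ! (Suc i mod m))" if "i < m" for i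
    using nth_cycle_edges[of i xs] that assms(1) xs(1)
    by (auto simp: spliceable_def step_edges_iff[symmetric])
  then show ?thesis using xs by (simp add: is_necklace_def)
qed

text \<open>Open \<open>xs\<close> at its upper handle and \<open>ys\<close> at its lower one; the
  lower handle of \<open>xs\<close> and the translated upper handle of \<open>ys\<close> remain for
  the next splice.\<close>

lemma splice:
  assumes "spliceable a b y m xs" "spliceable a b y n ys"
  obtains zs where "spliceable a b y (m + n) zs"
proof -
  have xs: "b < m" "distinct xs" "set xs = {0..<m}" "cycle_edges xs \<subseteq> step_edges a b"
    "{y, y + a} \<in> cycle_edges xs" "{m - b + y + a, m - b + y} \<in> cycle_edges xs" "xs \<noteq> []"
    using assms(1) by (auto simp: spliceable_def insert_commute)
  have ys: "b < n" "distinct ys" "set ys = {0..<n}" "cycle_edges ys \<subseteq> step_edges a b"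
    "{y, y + a} \<in> cycle_edges ys" "{n - b + y, n - b + y + a} \<in> cycle_edges ys" "ys \<noteq> []"
    using assms(2) by (auto simp: spliceable_def)
  obtain us where us: "us \<noteq> []" "distinct us" "set us = {0..<m}" "cycle_edges us = cycle_edges xs"
    "hd us = m - b + y + a" "last us = m - b + y"
    using cut_cycle[OF xs(6,7,2)] xs(3) by metis
  obtain vs where vs: "vs \<noteq> []" "distinct vs" "set vs = {0..<n}" "cycle_edges vs = cycle_edges ys"
    "hd vs = y" "last vs = y + a"
    using cut_cycle[OF ys(5,7,2)] ys(3) by metis
  define zs where "zs = us @ map ((+) m) vs"
  have edges: "cycle_edges zs = insert {m + y + a, m - b + y + a} (insert {m - b + y, m + y}
      (path_edges us \<union> (`) ((+) m) ` path_edges vs))"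
    using us vs
    by (simp add: zs_def cycle_edges_def path_edges_append path_edges_map hd_map last_map add.assoc)
  have "{m + y + a, m - b + y + a} \<in> step_edges a b" "{m - b + y, m + y} \<in> step_edges a b"
    unfolding step_edges_iff necklace_adj_def using xs(1) by auto
  moreover have "path_edges us \<subseteq> step_edges a b" "path_edges vs \<subseteq> step_edges a b"
    using us(4) vs(4) xs(4) ys(4)
      path_edges_subset_cycle_edges[of us] path_edges_subset_cycle_edges[of vs] by auto
  ultimately have "cycle_edges zs \<subseteq> step_edges a b"
    unfolding edges by (auto simp: step_edges_translate)
  \<comment> \<open>As \<open>b < m\<close>, this handle is not the edge that was cut, so it
    survives in the path; \<open>b < n\<close> does the same for \<open>ys\<close> below.\<close>
  moreover have "{y, y + a} \<in> path_edges us"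
  proof -
    have "{y, y + a} \<noteq> {last us, hd us}" using xs(1) us(5,6) by (auto simp: doubleton_eq_iff)
    then show ?thesis using xs(5) unfolding us(4) [symmetric] by (simp add: cycle_edges_def)
  qed
  then have "{y, y + a} \<in> cycle_edges zs"
    unfolding edges by blast
  moreover have "{n - b + y, n - b + y + a} \<in> path_edges vs"
  proof -
    have "{n - b + y, n - b + y + a} \<noteq> {last vs, hd vs}"
      using ys(1) vs(5,6) by (auto simp: doubleton_eq_iff)
    then show ?thesis using ys(6) unfolding vs(4) [symmetric] by (simp add: cycle_edges_def)
  qed
  then have "(+) m ` {n - b + y, n - b + y + a} \<in> cycle_edges zs"
    unfolding edges by blast
  then have "{m + n - b + y, m + n - b + y + a} \<in> cycle_edges zs"
    using ys(1) by (simp add: add.assoc)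
  moreover have "distinct zs" "set zs = {0..<m + n}"
  proof -
    have "set (map ((+) m) vs) = {m..<m + n}" using vs(3) by (simp add: add.commute)
    then show "set zs = {0..<m + n}" using us(3) by (auto simp: zs_def)
    show "distinct zs"
      using us(2,3) vs(2) by (auto simp: zs_def distinct_map)
  qed
  ultimately show ?thesis
    using that[of zs] xs(1) by (simp add: spliceable_def)
qed

lemma splice_multiple:
  assumes "spliceable a b y m xs" "spliceable a b y n ys" "0 < s + t"
  shows "\<exists>zs. spliceable a b y (s * m + t * n) zs"
proof -
  \<comment> \<open>Splicing has to start from an actual necklace, as there is none of length
    \<open>0\<close>; the case distinction on \<open>s\<close> picks the first one.\<close>
  have rep: "\<exists>zs. spliceable a b y (k + r * l) zs"
    if "spliceable a b y k us" "spliceable a b y l vs" for k l r us vs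
  proof (induction r)
    case 0
    then show ?case using that(1) by auto
  next
    case (Suc r)
    then obtain zs where "spliceable a b y (k + r * l) zs" by blast
    from splice[OF this that(2)] show ?case
      by (metis add.assoc add.commute mult_Suc)
  qed
  show ?thesis
  proof (cases s)
    case 0
    then obtain t' where "t = Suc t'" using assms(3) not0_implies_Suc by fastforce
    then show ?thesis using rep[OF assms(2,2), of t'] 0 by simp
  next
    case (Suc s')
    obtain zs where "spliceable a b y (s * m) zs"
      using rep[OF assms(1,1), of s'] Suc by auto
    then show ?thesis using rep[OF _ assms(2), of "s * m" zs t] by simp
  qed
qed

section \<open>The two building blocks\<close>

text \<open>Each bead \<open>z + a\<close> steps down to \<open>z\<close>, so every
  \<open>{z, z + a}\<close> with \<open>z < b\<close> is an edge. The handles are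
  \<open>z = y\<close> and \<open>z = a + y\<close>, whence the hypothesis on
  \<open>y\<close>.\<close>

lemma spliceable_add:
  fixes a b :: nat
  assumes "coprime a b" "0 < a" "y + a < b"
  shows "\<exists>xs. spliceable a b y (a + b) xs"
proof -
  have cop: "coprime b (a + b)"
    using assms(1) by (metis coprime_iff_gcd_eq_1 gcd.commute gcd_add1)
  obtain xs where xs: "distinct xs" "set xs = (\<Union>x<a + b. set [x])"
    "cycle_edges xs = (\<Union>x<a + b. insert {last [x], hd [(x + b) mod (a + b)]} (path_edges [x]))"
    by (rule concat_residue_cycle[OF cop, of "\<lambda>x. [x]"]) (use assms in auto)
  have nxt: "(x + b) mod (a + b) = (if x < a then x + b else x - a)" if "x < a + b" for x
    using that by (auto simp: mod_if)
  have E: "cycle_edges xs = (\<Union>x<a + b. {{x, if x < a then x + b else x - a}})"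
    unfolding xs(3) by (rule SUP_cong) (auto simp: nxt)
  have "cycle_edges xs \<subseteq> step_edges a b"
    unfolding E by (auto simp: step_edges_iff necklace_adj_def)
  moreover have "{z, z + a} \<in> cycle_edges xs" if "z < b" for z
    unfolding E using that by (auto intro!: bexI[of _ "z + a"] simp: insert_commute)
  ultimately show ?thesis
    using assms xs(1,2) by (intro exI[of _ xs]) (auto simp: spliceable_def)
qed

text \<open>The lower handle is the middle edge of a detour, which takes \<open>y < a\<close>. The
  upper one is the shifted step down from \<open>4 * a + y\<close>, which is kept if
  \<open>2 * a + y\<close> lies outside \<open>[b - a, b)\<close>. Both choices of \<open>y\<close>
  meet these demands.\<close>

lemma spliceable_add_triple:
  fixes a b :: nat
  assumes "coprime a b" "0 < a" "2 * a \<le> b"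
    and y: "3 * a < b \<and> y = 0 \<or> b < 3 * a \<and> y = b - 2 * a"
  shows "\<exists>xs. spliceable a b y (3 * a + b) xs"
proof -
  \<comment> \<open>The first beads of the blocks for \<open>x < a + b\<close> fill
    \<open>[2 * a, 3 * a + b)\<close>, the second beads of the long blocks \<open>[a, 2 * a)\<close>
    and the third ones \<open>[0, a)\<close>.\<close>
  define D where "D x = (if b - a \<le> x \<and> x < b then [x + 2 * a, x + 2 * a - b, x + a - b] else [x + 2 * a])" for x
  have cop: "coprime b (a + b)"
    using assms(1) by (metis coprime_iff_gcd_eq_1 gcd.commute gcd_add1)
  obtain xs where xs: "distinct xs" "set xs = (\<Union>x<a + b. set (D x))"
    "cycle_edges xs =
      (\<Union>x<a + b. insert {last (D x), hd (D ((x + b) mod (a + b)))} (path_edges (D x)))"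
  proof (rule concat_residue_cycle[OF cop, of D])
    show "distinct (D x)" for x using assms(2,3) by (auto simp: D_def)
    show "set (D x) \<inter> set (D z) = {}" if "x \<noteq> z" for x z
      using that assms(2,3) by (auto simp: D_def split: if_splits)
  qed (use assms in \<open>auto simp: D_def\<close>)
  have nxt: "(x + b) mod (a + b) = (if x < a then x + b else x - a)" if "x < a + b" for x
    using that by (auto simp: mod_if)
  have hd_D: "hd (D x) = x + 2 * a" for x by (simp add: D_def)
  have E: "cycle_edges xs = (\<Union>x<a + b.
      insert {last (D x), if x < a then x + b + 2 * a else x + a} (path_edges (D x)))"
    unfolding xs(3) by (rule SUP_cong) (auto simp: nxt hd_D)
  have "cycle_edges xs \<subseteq> step_edges a b"
    unfolding E using assms(2,3)
    by (auto simp: step_edges_iff necklace_adj_def D_def split: if_splits)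
  moreover have "set xs = {0..<3 * a + b}"
  proof
    show "set xs \<subseteq> {0..<3 * a + b}"
      unfolding xs(2) using assms(2,3) by (auto simp: D_def split: if_splits)
    show "{0..<3 * a + b} \<subseteq> set xs"
    proof
      fix z assume "z \<in> {0..<3 * a + b}"
      then consider "z < a" | "a \<le> z" "z < 2 * a" | "2 * a \<le> z" "z < 3 * a + b" by fastforce
      then show "z \<in> set xs"
      proof cases
        case 1
        then show ?thesis unfolding xs(2) using assms(2,3)
          by (auto simp: D_def intro!: bexI[of _ "z + b - a"])
      next
        case 2
        then show ?thesis unfolding xs(2) using assms(2,3)
          by (auto simp: D_def intro!: bexI[of _ "z + b - 2 * a"])
      next
        case 3
        then show ?thesis unfolding xs(2) 
          by (auto simp: D_def intro!: bexI[of _ "z - 2 * a"])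
      qed
    qed
  qed
  moreover have "{y, y + a} \<in> cycle_edges xs"
  proof -
    have "{y, y + a} \<in> path_edges (D (y + b - a))"
      using y assms(2,3) by (auto simp: D_def doubleton_eq_iff)
    moreover have "y + b - a < a + b" using y assms(2,3) by auto
    ultimately show ?thesis unfolding E by blast
  qed
  moreover have "{3 * a + y, 3 * a + y + a} \<in> cycle_edges xs"
  proof -
    have "last (D (2 * a + y)) = 3 * a + y + a" using y assms(2,3) by (auto simp: D_def)
    then have "{3 * a + y, 3 * a + y + a} =
        {last (D (2 * a + y)), if 2 * a + y < a then 2 * a + y + b + 2 * a else 2 * a + y + a}"
      by auto
    moreover have "2 * a + y < a + b" using y assms(2,3) by auto
    ultimately show ?thesis unfolding E by blast
  qed
  ultimately show ?thesis
    using assms xs(1) by (intro exI[of _ xs]) (auto simp: spliceable_def)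
qed

text \<open>
  For \<open>a = 1\<close> and \<open>b = 3\<close>, the necklace of length 6 made by detours contains for no \<open>y\<close> both
  edges needed for splicing, so this case takes the other one.
\<close>

lemma spliceable_1_3: "spliceable 1 3 0 6 [0, 1, 2, 5, 4, 3]"
proof -
  have "set [0, 1, 2, 5, 4, 3] = {0..<6::nat}" by auto
  moreover have "cycle_edges [0, 1, 2, 5, 4, 3] \<subseteq> step_edges 1 3"
    by (simp add: cycle_edges_def step_edges_iff necklace_adj_def)
  ultimately show ?thesis
    by (simp add: spliceable_def cycle_edges_def insert_commute)
qed

text \<open>Both building blocks must share one \<open>y\<close>, so the one chosen for length
  \<open>3 * a + b\<close> must also satisfy \<open>y + a < b\<close>.\<close>

lemma is_necklace_combination:
  fixes a b :: nat
  assumes "coprime a b" "0 < a" "2 * a \<le> b" "0 < s + t"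
  shows "\<exists>xs. is_necklace a b (s * (a + b) + t * (3 * a + b)) xs"
proof -
  \<comment> \<open>Here \<open>a\<close> divides \<open>b\<close>, so coprimality forces
    \<open>a = 1\<close>. Hence \<open>b = 3 * a\<close>, excluded in
    \<open>spliceable_add_triple\<close>, leaves only the pair \<open>1\<close>,
    \<open>3\<close>.\<close>
  have "a = 1" if "b = 2 * a \<or> b = 3 * a"
    using that assms(1) by auto
  then consider "3 * a < b" | "a = 1" "b = 3" | "b < 3 * a" 
    by linarith
  then obtain y ys where "y + a < b" and ys: "spliceable a b y (3 * a + b) ys"
  proof cases
    case 1
    then show ?thesis using spliceable_add_triple[OF assms(1-3), of 0] that[of 0] by auto
  next
    case 2
    then show ?thesis using spliceable_1_3 that[of 0] by simp
  next
    case 3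
    then show ?thesis
      using spliceable_add_triple[OF assms(1-3), of "b - 2 * a"] that[of "b - 2 * a"] assms(2,3)
      by auto
  qed
  then obtain xs where xs: "spliceable a b y (a + b) xs"
    using spliceable_add[OF assms(1,2)] by blast
  show ?thesis
    using splice_multiple[OF xs ys assms(4)] spliceable_is_necklace assms(2,3) by fastforce
qed

section \<open>The Frobenius bound\<close>

text \<open>Take \<open>i < p\<close> with \<open>i * q\<close> congruent to \<open>n\<close> mod
  \<open>p\<close>. If \<open>i * q\<close> exceeded \<open>n\<close>, it would be at least
  \<open>n + p\<close>, which is more than \<open>(p - 1) * q\<close>.\<close>

lemma frobenius_bound:
  fixes p q n :: nat
  assumes "coprime p q" "0 < p" "(p - 1) * (q - 1) \<le> n"
  obtains s t where "n = s * p + t * q"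
proof -
  obtain i where i: "i < p" "i * q mod p = n mod p"
  proof -
    have "n mod p \<in> (\<lambda>i. i * q mod p) ` {..<p}"
      using bij_betw_mult_mod[of q p] assms by (auto simp: bij_betw_def coprime_commute)
    then show ?thesis using that by auto
  qed
  have "i * q \<le> n"
  proof (rule ccontr)
    assume "\<not> i * q \<le> n"
    then have lt: "n < i * q" by simp
    have "p dvd i * q - n"
      using i(2) lt by (metis mod_eq_dvd_iff_nat less_imp_le)
    then have "p \<le> i * q - n" using lt by (intro dvd_imp_le) auto
    then have "n + p \<le> i * q" using lt by simp
    also have "\<dots> \<le> (p - 1) * q" using i(1) by (intro mult_right_mono) auto
    also have "\<dots> \<le> (p - 1) * (q - 1) + (p - 1)" by (cases q) auto
    also have "\<dots> < n + p" using assms by simp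
    finally show False by simp
  qed
  moreover from this have "p dvd n - i * q"
    using i(2) by (metis mod_eq_dvd_iff_nat)
  then obtain s where "n - i * q = p * s" ..
  ultimately have "n = s * p + i * q" by (simp add: mult.commute)
  then show ?thesis by (rule that)
qed

theorem theorem2p4:
  fixes a b :: nat
  assumes "a > 0" and "b > 0" and "coprime a b" and "2 * a \<le> b"
  shows "(even (a * b) \<longrightarrow>
            (\<forall>n::nat. n \<ge> (a + b - 1) * (3 * a + b - 1) \<longrightarrow> (\<exists>xs. is_necklace a b n xs))) \<and>
         (odd (a * b) \<longrightarrow>
            (\<forall>n::nat. even n \<and> n \<ge> (a + b - 2) * (3 * a + b - 2) div 2 \<longrightarrow>
              (\<exists>xs. is_necklace a b n xs)))"
proof (intro conjI impI allI)
  have cop: "coprime (a + b) a"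
    using assms(3) by (simp add: coprime_iff_gcd_eq_1 gcd.commute)
  have triple: "3 * a + b = (a + b) + 2 * a" by simp
  fix n :: nat
  {
    assume ev: "even (a * b)" and n: "(a + b - 1) * (3 * a + b - 1) \<le> n"
    \<comment> \<open>Exactly one of \<open>a\<close> and \<open>b\<close> is even, so
      \<open>a + b\<close> is coprime to \<open>2 * a\<close> and hence to
      \<open>3 * a + b\<close>.\<close>
    have "odd (a + b)" using ev assms(3) by (auto simp: coprime_def)
    then have "coprime (a + b) (2 * a)" using cop by simp
    then have "coprime (a + b) (3 * a + b)"
      by (simp only: triple coprime_iff_gcd_eq_1 gcd_add2)
    then obtain s t where st: "n = s * (a + b) + t * (3 * a + b)"
      by (rule frobenius_bound) (use n assms(1) in auto)
    \<comment> \<open>A positive bound excludes \<open>s = t = 0\<close>.\<close>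
    have "0 < (a + b - 1) * (3 * a + b - 1)" using assms(1,4) by simp
    then have "0 < n" using n by linarith
    then have "0 < s + t" using st by (metis add_0 gr0I mult_0 zero_eq_add_iff_both_eq_0)
    then show "\<exists>xs. is_necklace a b n xs"
      unfolding st by (rule is_necklace_combination[OF assms(3,1,4)])
  next
    assume od: "odd (a * b)" and n: "even n \<and> (a + b - 2) * (3 * a + b - 2) div 2 \<le> n"
    \<comment> \<open>Both lengths are even now, so the Frobenius bound is applied to their halves
      \<open>p\<close> and \<open>p + a\<close> and to \<open>m\<close>, half of
      \<open>n\<close>.\<close>
    then have "even (a + b)" by simp
    then obtain p where p: "a + b = 2 * p" ..
    obtain m where m: "n = 2 * m" using n by blast
    have q: "3 * a + b = 2 * (p + a)" using p by simp
    have "coprime p a" using cop by (simp add: p)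
    then have "coprime p (p + a)" by (simp only: coprime_iff_gcd_eq_1 gcd_add2)
    \<comment> \<open>For \<open>a = 1\<close> this gives \<open>b \<ge> 3\<close>, so that
      \<open>p \<ge> 2\<close> and the bound is positive.\<close>
    have "b \<noteq> 2" using od by auto
    then have "2 \<le> p" using assms p od by (cases "a = 1") auto
    have bound: "(p - 1) * (p + a - 1) \<le> m"
    proof -
      \<comment> \<open>Both factors are even, so the division by \<open>2\<close> is exact.\<close>
      have "a + b - 2 = 2 * (p - 1)" "3 * a + b - 2 = 2 * (p + a - 1)" using p q by auto
      then have "(a + b - 2) * (3 * a + b - 2) div 2 = 2 * ((p - 1) * (p + a - 1))" by simp
      then show ?thesis using n m by simp
    qed
    obtain s t where st: "m = s * p + t * (p + a)"
      by (rule frobenius_bound[OF \<open>coprime p (p + a)\<close> _ bound]) (use \<open>2 \<le> p\<close> in auto)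
    have "0 < (p - 1) * (p + a - 1)" using \<open>2 \<le> p\<close> assms(1) by simp
    then have "0 < m" using bound by linarith
    then have "0 < s + t" using st by (metis add_0 gr0I mult_0 zero_eq_add_iff_both_eq_0)
    moreover have "n = s * (a + b) + t * (3 * a + b)"
      unfolding p q m st by (simp add: algebra_simps)
    ultimately show "\<exists>xs. is_necklace a b n xs"
      using is_necklace_combination[OF assms(3,1,4)] by metis
  }
qed

end
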